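(* For $p=1$, there is a randomized online algorithm for the Unrelated Machine Scheduling with Startup Cost problem with bi-criteria competitive ratio $(O(\log m\log n),\,O(1))$.
   Context: Unrelated Machine Scheduling with Startup Cost: there is a set $M$ of $m$ machines, machine $i$ having startup cost $c_i\ge0$, and a set $J$ of $n$ jobs arriving online one at a time; job $j$ has processing time $p_{ij}\ge0$ on machine $i$. Upon arrival each job must be irrevocably assigned to a machine. The load $L_i$ of machine $i$ is the sum of processing times of jobs assigned to it; a machine is open if at least one job is assigned to it, and the cost of the schedule is the sum of startup costs of open machines. For $p=1$ the load objective is the total load $\sum_{i\in M}L_i$. The algorithm is given in advance a pair $(\mathbf C,\mathbf L)$ with the guarantee that some schedule of all jobs has cost at most $\mathbf C$ and total load at most $\mathbf L$. A randomized algorithm has bi-criteria competitive ratio $(\alpha,\beta)$ if it always produces a schedule with expected cost at most $\alpha\mathbf C$ and expected total load at most $\beta\mathbf L$. *)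

theory Defs
  imports "HOL-Probability.Probability"
begin

text \<open>Machines are the indices 0..<m. A job is given by its vector of processing
  times, a function nat => real (only the values at indices < m matter).
  A deterministic online algorithm receives, in advance, the number of machines m,
  the startup costs c and the guarantee pair (C, L); on arrival of each job it sees
  the list of all jobs arrived so far (the current job last) and returns the machine
  for the current job.  Its previous decisions are a function of the same data, so
  the decision for job j depends only on the prefix of jobs up to j (online-ness).
  The number n of jobs is not revealed in advance.\<close>

type_synonym online_alg =
  "nat \<Rightarrow> (nat \<Rightarrow> real) \<Rightarrow> real \<Rightarrow> real \<Rightarrow> (nat \<Rightarrow> real) list \<Rightarrow> nat"

definition sched :: "online_alg \<Rightarrow> nat \<Rightarrow> (nat \<Rightarrow> real) \<Rightarrow> real \<Rightarrow> real
    \<Rightarrow> (nat \<Rightarrow> real) list \<Rightarrow> nat list" where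
  "sched A m c C L js = map (\<lambda>k. A m c C L (take (Suc k) js)) [0..<length js]"

definition sched_cost :: "nat \<Rightarrow> (nat \<Rightarrow> real) \<Rightarrow> nat list \<Rightarrow> real" where
  "sched_cost m c \<sigma> = (\<Sum>i\<in>{i. i < m \<and> i \<in> set \<sigma>}. c i)"

definition total_load :: "(nat \<Rightarrow> real) list \<Rightarrow> nat list \<Rightarrow> real" where
  "total_load js \<sigma> = (\<Sum>j<length js. (js ! j) (\<sigma> ! j))"

definition valid_schedule :: "nat \<Rightarrow> (nat \<Rightarrow> real) list \<Rightarrow> nat list \<Rightarrow> bool" where
  "valid_schedule m js \<sigma> \<longleftrightarrow> length \<sigma> = length js \<and> set \<sigma> \<subseteq> {..<m}"

definition valid_instance :: "nat \<Rightarrow> (nat \<Rightarrow> real) \<Rightarrow> (nat \<Rightarrow> real) list \<Rightarrow> bool" where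
  "valid_instance m c js \<longleftrightarrow> (\<forall>i<m. 0 \<le> c i) \<and> (\<forall>p\<in>set js. \<forall>i<m. 0 \<le> p i)"

definition feasible_guess ::
  "nat \<Rightarrow> (nat \<Rightarrow> real) \<Rightarrow> (nat \<Rightarrow> real) list \<Rightarrow> real \<Rightarrow> real \<Rightarrow> bool" where
  "feasible_guess m c js C L \<longleftrightarrow>
     (\<exists>\<sigma>. valid_schedule m js \<sigma> \<and> sched_cost m c \<sigma> \<le> C \<and> total_load js \<sigma> \<le> L)"

end

theory Submission
  imports Defs
begin

text \<open>The fractional openings \<open>x\<close> follow an implicit mirror descent step per job: for the level
  \<open>T\<close> at which the machines of processing time at most \<open>T\<close> reach total weight \<open>1\<close>, each
  \<open>x i\<close> is multiplied by \<open>exp (max 0 (T - q i) / c i)\<close>, where \<open>q\<close> is the vector of processing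
  times, scaled so that the guarantee \<open>L\<close> becomes \<open>C * ln (m + 1)\<close>.  One step costs at most
  \<open>T\<close>, and it raises the potential \<open>\<Sum>i\<in>OPT. c i * ln (x i)\<close>, whose range is
  \<open>C * ln m\<close>, by at least \<open>T\<close> minus the optimum's scaled time.  Hence the levels add up to at most
  \<open>2 * C * ln (m + 1)\<close>, which bounds the load by \<open>O(L)\<close> and the fractional cost by
  \<open>O(log m) * C\<close>.

  For the rounding every machine draws a uniform threshold, and the \<open>k\<close>-th job may use the machines
  of time at most \<open>T\<close> with threshold at most \<open>2 * ln (k + 1) * x i\<close>.  By independence none
  qualifies with probability at most \<open>1 / (k + 1)\<^sup>2\<close>; the job then goes to its fastest machine of
  startup cost at most \<open>C\<close>, at total expected cost \<open>O(C)\<close> and never more load than the optimum.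
  Letting the rate depend on \<open>k\<close> makes it unnecessary to know the number of jobs.\<close>

subsection \<open>The fractional step\<close>

text \<open>The level is where the weight jumps past \<open>1\<close>. A machine of startup cost \<open>0\<close> has weight \<open>1\<close> from the start; the last
  conjunct keeps it out of the second sum, where \<open>(T - q i) / c i\<close> would be a division by zero.\<close>

definition is_level ::
  "nat set \<Rightarrow> (nat \<Rightarrow> real) \<Rightarrow> (nat \<Rightarrow> real) \<Rightarrow> (nat \<Rightarrow> real) \<Rightarrow> real \<Rightarrow> bool" where
  "is_level A c q x T \<longleftrightarrow>
     1 \<le> (\<Sum>i | i \<in> A \<and> q i \<le> T. x i * exp ((T - q i) / c i)) \<and>
     (\<Sum>i | i \<in> A \<and> q i < T. x i * exp ((T - q i) / c i)) \<le> 1 \<and>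
     (\<forall>i\<in>A. c i = 0 \<longrightarrow> T \<le> q i)"

text \<open>The weight \<open>H\<close> is monotone but jumps where a machine enters, so
  \<open>T\<close> is the infimum of the points where it has reached \<open>1\<close>. The limits
  from the right and from the left at \<open>T\<close> give the two inequalities.\<close>

lemma ex_level:
  fixes A :: "nat set" and c q x :: "nat \<Rightarrow> real"
  assumes "finite A" "A \<noteq> {}"
    and x: "\<And>i. i \<in> A \<Longrightarrow> 0 < x i" and c: "\<And>i. i \<in> A \<Longrightarrow> 0 \<le> c i"
    and free: "\<And>i. i \<in> A \<Longrightarrow> c i = 0 \<Longrightarrow> x i = 1"
  shows "\<exists>T. is_level A c q x T"
proof -
  define F where "F B t = (\<Sum>i\<in>B. x i * exp ((t - q i) / c i))" for B t
  define H where "H t = F {i. i \<in> A \<and> q i \<le> t} t" for t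
  define T where "T = Inf {t. 1 \<le> H t}"
  have F_mono: "F B s \<le> F B' t" if "B \<subseteq> B'" "B' \<subseteq> A" "s \<le> t" for B B' s t
  proof -
    have "F B s \<le> F B t"
      unfolding F_def using that x c
      by (intro sum_mono mult_left_mono) (auto intro!: divide_right_mono simp: less_imp_le subset_eq)
    also have "\<dots> \<le> F B' t"
      unfolding F_def using that x finite_subset[OF that(2) assms(1)]
      by (intro sum_mono2) (auto simp: less_imp_le subset_eq)
    finally show ?thesis .
  qed
  have H_mono: "H s \<le> H t" if "s \<le> t" for s t
    unfolding H_def using that by (intro F_mono) auto
  have F_tendsto: "(F B \<longlongrightarrow> F B t) (at t within S)" for B t S
    unfolding F_def by (auto intro!: tendsto_intros simp: divide_inverse)
  obtain k where k: "k \<in> A" using assms(2) by blast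
  \<comment> \<open>At \<open>t0\<close> machine \<open>k\<close> alone has weight at least
    \<open>1\<close>. For \<open>c k = 0\<close> the exponent is \<open>0\<close>, and
    \<open>x k = 1\<close> suffices.\<close>
  define t0 where "t0 = q k + max 0 (c k * ln (1 / x k))"
  have single: "x i * exp ((t - q i) / c i) \<le> H t" if "i \<in> A" "q i \<le> t" for i t
    using F_mono[of "{i}" "{i. i \<in> A \<and> q i \<le> t}" t t] that by (auto simp: H_def F_def)
  have "1 \<le> x k * exp ((t0 - q k) / c k)"
  proof (cases "c k = 0")
    case False
    have "c k > 0" using False c[OF k] by simp
    have "c k * ln (1 / x k) / c k \<le> (t0 - q k) / c k"
      using \<open>c k > 0\<close> by (intro divide_right_mono) (auto simp: t0_def)
    then have "exp (ln (1 / x k)) \<le> exp ((t0 - q k) / c k)"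
      using False by simp
    then have "1 \<le> x k * exp ((t0 - q k) / c k)"
      using x[OF k] by (simp add: field_simps)
    then show ?thesis .
  qed (use k free in simp)
  then have "1 \<le> H t0"
    using single[of k t0] k by (auto simp: t0_def)
  then have ne: "{t. 1 \<le> H t} \<noteq> {}" by auto
  have "Min (q ` A) \<le> t" if "1 \<le> H t" for t
  proof (rule ccontr)
    assume "\<not> Min (q ` A) \<le> t"
    then have "{i. i \<in> A \<and> q i \<le> t} = {}"
      using assms(1,2) by (auto simp: not_le)
    then have "H t = 0" by (simp only: H_def F_def sum.empty)
    then show False using that by simp
  qed
  then have bdd: "bdd_below {t. 1 \<le> H t}" by (intro bdd_belowI) auto
  have above: "1 \<le> H t" if t: "T < t" for t
  proof -
    obtain s where "1 \<le> H s" "s < t"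
      using t ne bdd unfolding T_def by (auto simp: cInf_less_iff)
    then show ?thesis using H_mono[of s t] by simp
  qed
  have below: "H t < 1" if t: "t < T" for t
    using cInf_lower[OF _ bdd, of t] t unfolding T_def by force
  \<comment> \<open>Close to \<open>T\<close> the set of machines that count is constant on each
    side, so only the continuous exponentials vary in the limit.\<close>
  have ev1: "\<forall>\<^sub>F t in at_right T. \<forall>i\<in>A. q i \<le> t \<longleftrightarrow> q i \<le> T"
  proof (rule eventually_ball_finite[OF assms(1)], rule ballI)
    fix i
    show "\<forall>\<^sub>F t in at_right T. (q i \<le> t) = (q i \<le> T)"
    proof (cases "q i \<le> T")
      case False
      then show ?thesis
        by (intro eventually_at_rightI[of T "q i"]) auto
    qed (auto intro!: eventually_at_rightI[of T "T + 1"])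
  qed
  have ev2: "\<forall>\<^sub>F t in at_left T. \<forall>i\<in>A. q i \<le> t \<longleftrightarrow> q i < T"
  proof (rule eventually_ball_finite[OF assms(1)], rule ballI)
    fix i
    show "\<forall>\<^sub>F t in at_left T. (q i \<le> t) = (q i < T)"
    proof (cases "q i < T")
      case True
      then show ?thesis
        by (intro eventually_at_leftI[of "q i" T]) auto
    qed (auto intro!: eventually_at_leftI[of "T - 1" T])
  qed
  have "1 \<le> F {i. i \<in> A \<and> q i \<le> T} T"
  proof (rule tendsto_lowerbound[OF F_tendsto])
    have "\<forall>\<^sub>F t in at_right T. T < t" by (simp add: eventually_at_right_less)
    with ev1 show "\<forall>\<^sub>F t in at_right T. 1 \<le> F {i. i \<in> A \<and> q i \<le> T} t"
    proof eventually_elim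
      case (elim t)
      then have "{i. i \<in> A \<and> q i \<le> T} = {i. i \<in> A \<and> q i \<le> t}" by blast
      then show ?case using above[OF elim(2)] by (simp add: H_def)
    qed
  qed simp
  moreover have "F {i. i \<in> A \<and> q i < T} T \<le> 1"
  proof (rule tendsto_upperbound[OF F_tendsto])
    have "\<forall>\<^sub>F t in at_left T. t < T" by (auto intro!: eventually_at_leftI[of "T - 1"])
    with ev2 show "\<forall>\<^sub>F t in at_left T. F {i. i \<in> A \<and> q i < T} t \<le> 1"
    proof eventually_elim
      case (elim t)
      then have "{i. i \<in> A \<and> q i < T} = {i. i \<in> A \<and> q i \<le> t}" by blast
      then show ?case using below[OF elim(2)] by (simp add: H_def)
    qed
  qed simp
  \<comment> \<open>A free machine has weight \<open>1\<close> as soon as it enters, so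
    \<open>H\<close> has reached \<open>1\<close> at \<open>q i\<close> already.\<close>
  moreover have "T \<le> q i" if "i \<in> A" "c i = 0" for i
    using single[of i "q i"] that free below[of "q i"] by force
  ultimately show ?thesis by (auto simp: is_level_def F_def)
qed

definition raise_to ::
  "nat set \<Rightarrow> (nat \<Rightarrow> real) \<Rightarrow> (nat \<Rightarrow> real) \<Rightarrow> real \<Rightarrow> (nat \<Rightarrow> real) \<Rightarrow> nat \<Rightarrow> real" where
  "raise_to A c q T x i = (if i \<in> A \<and> q i < T then x i * exp ((T - q i) / c i) else x i)"

context
  fixes A :: "nat set" and c q x :: "nat \<Rightarrow> real" and T :: real
  assumes fin: "finite A" and lev: "is_level A c q x T"
    and x: "\<And>i. 0 < x i" and c: "\<And>i. i \<in> A \<Longrightarrow> 0 \<le> c i" and q: "\<And>i. i \<in> A \<Longrightarrow> 0 \<le> q i"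
begin

lemma cost_pos_below_level: "i \<in> A \<Longrightarrow> q i < T \<Longrightarrow> 0 < c i"
  using lev c[of i] unfolding is_level_def by force

lemma level_nonneg: "0 \<le> T"
proof (rule ccontr)
  assume "\<not> 0 \<le> T"
  then have "{i. i \<in> A \<and> q i \<le> T} = {}" using q by force
  then show False using lev unfolding is_level_def by (metis not_one_le_zero sum.empty)
qed

lemma raise_to_ge: "x i \<le> raise_to A c q T x i"
  using cost_pos_below_level[of i] x[of i] by (auto simp: raise_to_def)

lemma raise_to_pos: "0 < raise_to A c q T x i"
  using x by (simp add: raise_to_def)

text \<open>The raised weight of a machine below the level is one term of the second sum in
  \<open>is_level\<close>.\<close>

lemma raise_to_le_one:
  assumes "x i \<le> 1"
  shows "raise_to A c q T x i \<le> 1"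
proof (cases "i \<in> A \<and> q i < T")
  case True
  have "x i * exp ((T - q i) / c i) \<le> (\<Sum>i | i \<in> A \<and> q i < T. x i * exp ((T - q i) / c i))"
    using True fin x by (intro member_le_sum) (auto simp: less_imp_le)
  with True show ?thesis using lev by (simp add: raise_to_def is_level_def)
qed (use assms in \<open>auto simp: raise_to_def\<close>)

text \<open>At \<open>q i = T\<close> the factor is \<open>exp 0 = 1\<close>, so the strict
  comparison in \<open>raise_to\<close> agrees with the weak one in the first sum of
  \<open>is_level\<close>.\<close>

lemma one_le_sum_raise_to: "1 \<le> (\<Sum>i | i \<in> A \<and> q i \<le> T. raise_to A c q T x i)"
proof -
  have "(\<Sum>i | i \<in> A \<and> q i \<le> T. x i * exp ((T - q i) / c i)) =
        (\<Sum>i | i \<in> A \<and> q i \<le> T. raise_to A c q T x i)"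
    by (intro sum.cong) (auto simp: raise_to_def)
  with lev show ?thesis by (simp add: is_level_def)
qed

text \<open>Equality holds below the level; elsewhere the weight stays put and the left side is at
  most \<open>0\<close>.\<close>

lemma ln_raise_to_gain:
  assumes "i \<in> A"
  shows "T - q i \<le> c i * (ln (raise_to A c q T x i) - ln (x i))"
  using cost_pos_below_level[of i] assms x[of i] by (auto simp: raise_to_def ln_mult)

text \<open>The inequality \<open>exp d - 1 \<le> d * exp d\<close> bounds the cost increase on a
  machine by \<open>T - q i\<close>, hence by \<open>T\<close>, times its new weight. The new
  weights strictly below the level sum to at most \<open>1\<close>.\<close>

lemma raise_to_cost:
  assumes "finite I"
  shows "(\<Sum>i\<in>I. c i * (raise_to A c q T x i - x i)) \<le> T"
proof -
  have "(\<Sum>i\<in>I. c i * (raise_to A c q T x i - x i)) \<le>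
        (\<Sum>i\<in>I. if i \<in> A \<and> q i < T then T * (x i * exp ((T - q i) / c i)) else 0)"
  proof (rule sum_mono)
    fix i
    show "c i * (raise_to A c q T x i - x i) \<le>
        (if i \<in> A \<and> q i < T then T * (x i * exp ((T - q i) / c i)) else 0)"
    proof (cases "i \<in> A \<and> q i < T")
      case True
      define d where "d = (T - q i) / c i"
      have ci: "c i > 0" using True cost_pos_below_level by blast
      have "1 + - d \<le> exp (- d)" by (rule exp_ge_add_one_self)
      then have "(1 - d) * exp d \<le> exp (- d) * exp d" by (intro mult_right_mono) auto
      then have "exp d - 1 \<le> d * exp d" by (simp flip: exp_add add: algebra_simps)
      then have "c i * x i * (exp d - 1) \<le> c i * x i * (d * exp d)"
        using ci x[of i] by (intro mult_left_mono) auto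
      also have "\<dots> = (T - q i) * (x i * exp d)"
        using ci by (simp add: d_def)
      also have "\<dots> \<le> T * (x i * exp d)"
        using x[of i] q[of i] True by (intro mult_right_mono) (auto simp: less_imp_le)
      finally show ?thesis using True by (simp add: raise_to_def d_def algebra_simps)
    qed (auto simp: raise_to_def)
  qed
  also have "\<dots> = (\<Sum>i | i \<in> I \<and> i \<in> A \<and> q i < T. T * (x i * exp ((T - q i) / c i)))"
    using assms by (simp add: sum.If_cases Int_def)
  also have "\<dots> \<le> (\<Sum>i | i \<in> A \<and> q i < T. T * (x i * exp ((T - q i) / c i)))"
    using fin x level_nonneg by (intro sum_mono2) (auto simp: less_imp_le)
  also have "\<dots> \<le> T * 1"
    unfolding sum_distrib_left[symmetric] using lev level_nonneg
    by (intro mult_left_mono) (auto simp: is_level_def)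
  finally show ?thesis by simp
qed

end

subsection \<open>The algorithm\<close>

locale startup =
  fixes m :: nat and c :: "nat \<Rightarrow> real" and C L :: real
begin

text \<open>The case \<open>C = 0\<close> only keeps \<open>scale\<close> positive. If \<open>L = 0\<close>, then \<open>scaled\<close> is \<open>0\<close>, which is
  correct because usable machines then have processing time \<open>0\<close>.\<close>

definition scale :: real where
  "scale = (if C = 0 then 1 else C * ln (real m + 1))"

text \<open>Since costs and times are nonnegative, a schedule within the guarantee never leaves this
  set.\<close>

definition usable :: "(nat \<Rightarrow> real) \<Rightarrow> nat set" where
  "usable p = {i. i < m \<and> c i \<le> C \<and> p i \<le> L}"

definition scaled :: "(nat \<Rightarrow> real) \<Rightarrow> nat \<Rightarrow> real" where
  "scaled p i = p i * scale / L"

definition level :: "(nat \<Rightarrow> real) \<Rightarrow> (nat \<Rightarrow> real) \<Rightarrow> real" where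
  "level x p = (SOME T. is_level (usable p) c (scaled p) x T)"

definition step :: "(nat \<Rightarrow> real) \<Rightarrow> (nat \<Rightarrow> real) \<Rightarrow> nat \<Rightarrow> real" where
  "step x p = raise_to (usable p) c (scaled p) (level x p) x"

text \<open>Starting at \<open>1 / real m\<close> keeps the initial fractional cost of the machines
  affordable within \<open>C\<close> at most \<open>C\<close>, while the logarithm of a weight can
  still grow by only \<open>ln m\<close>. Free machines start fully open.\<close>

definition weights :: "(nat \<Rightarrow> real) list \<Rightarrow> nat \<Rightarrow> real" where
  "weights = foldl step (\<lambda>i. if c i = 0 then 1 else 1 / real m)"

text \<open>The level belongs to the weights before the last job, hence \<open>butlast\<close>;
  \<open>hit\<close> compares thresholds with the weights after its step, which are the ones that
  sum to at least \<open>1\<close> over the candidates.\<close>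

definition candidates :: "(nat \<Rightarrow> real) list \<Rightarrow> nat set" where
  "candidates js = {i \<in> usable (last js).
     scaled (last js) i \<le> level (weights (butlast js)) (last js)}"

definition rate :: "nat \<Rightarrow> real" where
  "rate n = 2 * ln (real n + 1)"

definition hit :: "(nat \<Rightarrow> real) \<Rightarrow> (nat \<Rightarrow> real) list \<Rightarrow> nat \<Rightarrow> bool" where
  "hit \<omega> js i \<longleftrightarrow> i \<in> candidates js \<and> \<omega> i \<le> rate (length js) * weights js i"

definition fallback :: "(nat \<Rightarrow> real) \<Rightarrow> nat" where
  "fallback p = arg_min_on p {i. i < m \<and> c i \<le> C}"

definition choice :: "(nat \<Rightarrow> real) \<Rightarrow> (nat \<Rightarrow> real) list \<Rightarrow> nat" where
  "choice \<omega> js = (if \<exists>i. hit \<omega> js i then LEAST i. hit \<omega> js i else fallback (last js))"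

lemma rate_nonneg: "0 \<le> rate n"
  by (simp add: rate_def)

lemma rate_mono: "k \<le> n \<Longrightarrow> rate k \<le> rate n"
  by (simp add: rate_def)

lemma weights_snoc: "weights (js @ [p]) = step (weights js) p"
  by (simp add: weights_def)

lemma finite_usable: "finite (usable p)"
  by (simp add: usable_def)

lemma finite_candidates: "finite (candidates js)"
  using finite_usable by (simp add: candidates_def)

lemma choice_hit: "\<exists>i. hit \<omega> js i \<Longrightarrow> hit \<omega> js (choice \<omega> js)"
  unfolding choice_def by (auto intro: LeastI_ex)

end

definition startup_alg :: "(nat \<Rightarrow> real) \<Rightarrow> online_alg" where
  "startup_alg \<omega> m c C L js = startup.choice m c C L \<omega> js"

section \<open>Analysis of one instance against a schedule \<open>opt\<close> witnessing the
  guarantee\<close>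

locale startup_instance = startup +
  fixes js :: "(nat \<Rightarrow> real) list" and opt :: "nat list"
  assumes valid: "valid_instance m c js" and nonempty: "js \<noteq> []"
    and opt_valid: "valid_schedule m js opt"
    and opt_cost: "sched_cost m c opt \<le> C" and opt_load: "total_load js opt \<le> L"
begin

text \<open>Jobs are numbered from \<open>0\<close>: job \<open>k\<close> moves \<open>x k\<close>
  to \<open>x (Suc k)\<close> at level \<open>T k\<close>, and \<open>arrived k\<close> includes job
  \<open>k\<close>.\<close>

abbreviation "x k \<equiv> weights (take k js)"
abbreviation "T k \<equiv> level (x k) (js ! k)"
abbreviation "arrived k \<equiv> take (Suc k) js"

lemma c_nonneg: "i < m \<Longrightarrow> 0 \<le> c i"
  using valid by (simp add: valid_instance_def)

lemma p_nonneg: "k < length js \<Longrightarrow> i < m \<Longrightarrow> 0 \<le> (js ! k) i"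
  using valid by (simp add: valid_instance_def)

lemma opt_less: "k < length js \<Longrightarrow> opt ! k < m"
  using opt_valid unfolding valid_schedule_def by (metis lessThan_iff nth_mem subsetD)

lemma opt_mem: "k < length js \<Longrightarrow> opt ! k \<in> set opt"
  using opt_valid by (simp add: valid_schedule_def)

lemma m_pos: "0 < m"
  using opt_less[of 0] nonempty by (cases m) auto

lemma opt_machine_cost: "i < m \<Longrightarrow> i \<in> set opt \<Longrightarrow> c i \<le> C"
  using opt_cost c_nonneg member_le_sum[of i "{i. i < m \<and> i \<in> set opt}" c]
  by (force simp: sched_cost_def)

lemma opt_job_load: "k < length js \<Longrightarrow> (js ! k) (opt ! k) \<le> L"
  using opt_load member_le_sum[of k "{..<length js}" "\<lambda>k. (js ! k) (opt ! k)"] p_nonneg opt_less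
  by (force simp: total_load_def)

lemma C_nonneg: "0 \<le> C"
  using opt_machine_cost[OF opt_less opt_mem, of 0] c_nonneg[OF opt_less, of 0] nonempty by force

lemma L_nonneg: "0 \<le> L"
  using opt_job_load[of 0] p_nonneg[OF _ opt_less, of 0 0] nonempty by force

lemma scale_pos: "0 < scale"
  using C_nonneg m_pos by (simp add: scale_def)

lemma opt_usable: "k < length js \<Longrightarrow> opt ! k \<in> usable (js ! k)"
  by (simp add: usable_def opt_less opt_machine_cost opt_mem opt_job_load)

lemma scaled_nonneg: "k < length js \<Longrightarrow> i \<in> usable (js ! k) \<Longrightarrow> 0 \<le> scaled (js ! k) i"
  using scale_pos L_nonneg p_nonneg by (auto simp: scaled_def usable_def)

lemma arrived_eq: "k < length js \<Longrightarrow> arrived k = take k js @ [js ! k]"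
  by (simp add: take_Suc_conv_app_nth)

lemma x_Suc: "k < length js \<Longrightarrow> x (Suc k) = step (x k) (js ! k)"
  by (simp add: arrived_eq weights_snoc)

lemma x_0: "x 0 i = (if c i = 0 then 1 else 1 / real m)"
  by (simp add: weights_def)

lemma last_arrived: "k < length js \<Longrightarrow> last (arrived k) = js ! k"
  by (simp add: arrived_eq)

lemma candidates_arrived:
  "k < length js \<Longrightarrow>
    candidates (arrived k) = {i. i \<in> usable (js ! k) \<and> scaled (js ! k) i \<le> T k}"
  by (simp add: arrived_eq candidates_def)

lemma is_level_level:
  assumes k: "k < length js" and "\<And>i. 0 < x k i" and "\<And>i. c i = 0 \<Longrightarrow> x k i = 1"
  shows "is_level (usable (js ! k)) c (scaled (js ! k)) (x k) (T k)"
  unfolding level_def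
proof (rule someI_ex, rule ex_level)
  show "usable (js ! k) \<noteq> {}" using opt_usable[OF k] by blast
  show "0 \<le> c i" if "i \<in> usable (js ! k)" for i
    using that c_nonneg by (simp add: usable_def)
qed (use assms finite_usable in auto)

text \<open>Positivity and weight \<open>1\<close> on free machines make a level exist. In turn the
  level caps the new weights at \<open>1\<close> and leaves free machines untouched.\<close>

lemma x_invariant:
  assumes "k \<le> length js"
  shows "0 < x k i \<and> x k i \<le> 1 \<and> (c i = 0 \<longrightarrow> x k i = 1)"
  using assms
proof (induction k arbitrary: i)
  case 0
  then show ?case using m_pos unfolding x_0 by simp
next
  case (Suc k)
  have k: "k < length js" using Suc.prems by simp
  have inv: "0 < x k i \<and> x k i \<le> 1 \<and> (c i = 0 \<longrightarrow> x k i = 1)" for i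
    using Suc.IH k by simp
  have lev: "is_level (usable (js ! k)) c (scaled (js ! k)) (x k) (T k)"
    using k inv by (intro is_level_level) auto
  have c: "0 \<le> c i" if "i \<in> usable (js ! k)" for i
    using that c_nonneg by (simp add: usable_def)
  \<comment> \<open>\<open>F\<close> lists, in order, the premises shared by the facts about a
    single raising step.\<close>
  note F = finite_usable lev conjunct1[OF inv] c scaled_nonneg[OF k]
  have eq: "x (Suc k) i = raise_to (usable (js ! k)) c (scaled (js ! k)) (T k) (x k) i"
    using k by (simp add: x_Suc step_def)
  have "c i = 0 \<Longrightarrow> x (Suc k) i = 1"
    using cost_pos_below_level[OF F, of i] inv[of i] unfolding eq by (auto simp: raise_to_def)
  then show ?case
    using raise_to_pos[OF F, of i] raise_to_le_one[OF F, of i] inv[of i] unfolding eq by blast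
qed

lemma
  assumes k: "k < length js"
  shows x_mono_Suc: "x k i \<le> x (Suc k) i"
    and T_nonneg: "0 \<le> T k"
    and sum_candidates: "1 \<le> (\<Sum>i\<in>candidates (arrived k). x (Suc k) i)"
    and ln_gain: "i \<in> usable (js ! k) \<Longrightarrow>
          T k - scaled (js ! k) i \<le> c i * (ln (x (Suc k) i) - ln (x k i))"
    and cost_gain: "(\<Sum>i | i < m \<and> c i \<le> C. c i * (x (Suc k) i - x k i)) \<le> T k"
proof -
  have inv: "0 < x k i \<and> x k i \<le> 1 \<and> (c i = 0 \<longrightarrow> x k i = 1)" for i
    using x_invariant[of k] k by simp
  have lev: "is_level (usable (js ! k)) c (scaled (js ! k)) (x k) (T k)"
    using k inv by (intro is_level_level) auto
  have c: "0 \<le> c i" if "i \<in> usable (js ! k)" for i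
    using that c_nonneg by (simp add: usable_def)
  note F = finite_usable lev conjunct1[OF inv] c scaled_nonneg[OF k]
  have eq: "x (Suc k) = raise_to (usable (js ! k)) c (scaled (js ! k)) (T k) (x k)"
    using k by (simp add: x_Suc step_def)
  show "x k i \<le> x (Suc k) i" using raise_to_ge[OF F] unfolding eq by blast
  show "0 \<le> T k" using level_nonneg[OF F] by blast
  show "1 \<le> (\<Sum>i\<in>candidates (arrived k). x (Suc k) i)"
    using one_le_sum_raise_to[OF F] unfolding eq candidates_arrived[OF k] by simp
  show "T k - scaled (js ! k) i \<le> c i * (ln (x (Suc k) i) - ln (x k i))"
    if "i \<in> usable (js ! k)"
    using ln_raise_to_gain[OF F that] unfolding eq by simp
  show "(\<Sum>i | i < m \<and> c i \<le> C. c i * (x (Suc k) i - x k i)) \<le> T k"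
    using raise_to_cost[OF F] unfolding eq by simp
qed

lemma x_mono:
  assumes "k \<le> l" "l \<le> length js"
  shows "x k i \<le> x l i"
  using assms
proof (induction l rule: dec_induct)
  case (step l)
  then show ?case using x_mono_Suc[of l i] by simp
qed simp

section \<open>Potential argument and the fractional cost\<close>

lemma sum_excess:
  assumes "k \<le> length js"
  shows "(\<Sum>j<k. T j - scaled (js ! j) (opt ! j)) \<le>
    (\<Sum>i | i < m \<and> i \<in> set opt. c i * (ln (x k i) - ln (x 0 i)))"
  using assms
proof (induction k)
  case (Suc k)
  have k: "k < length js" using Suc.prems by simp
  let ?O = "{i. i < m \<and> i \<in> set opt}"
  have "T k - scaled (js ! k) (opt ! k)
      \<le> c (opt ! k) * (ln (x (Suc k) (opt ! k)) - ln (x k (opt ! k)))"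
    by (rule ln_gain[OF k opt_usable[OF k]])
  \<comment> \<open>Weights never decrease, so the other machines of \<open>opt\<close> contribute
    nonnegative gains.\<close>
  also have "\<dots> \<le> (\<Sum>i\<in>?O. c i * (ln (x (Suc k) i) - ln (x k i)))"
  proof (rule member_le_sum)
    show "0 \<le> c i * (ln (x (Suc k) i) - ln (x k i))" if "i \<in> ?O - {opt ! k}" for i
      using that c_nonneg[of i] x_mono_Suc[OF k, of i] x_invariant[of k i] x_invariant[of "Suc k" i] k
      by simp
  qed (use opt_less opt_mem k in auto)
  finally have "(\<Sum>j<Suc k. T j - scaled (js ! j) (opt ! j)) \<le>
      (\<Sum>i\<in>?O. c i * (ln (x k i) - ln (x 0 i))) + (\<Sum>i\<in>?O. c i * (ln (x (Suc k) i) - ln (x k i)))"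
    using Suc.IH k by simp
  also have "\<dots> = (\<Sum>i\<in>?O. c i * (ln (x (Suc k) i) - ln (x 0 i)))"
    unfolding sum.distrib[symmetric] by (intro sum.cong) (auto simp: algebra_simps)
  finally show ?case .
qed simp

text \<open>The weight of a paid machine rises from \<open>1 / real m\<close> to at most
  \<open>1\<close>, and free machines contribute \<open>0\<close>. Using
  \<open>ln (real m + 1)\<close> in place of \<open>ln m\<close> keeps the bound positive for
  \<open>m = 1\<close>.\<close>

lemma potential_le_scale:
  "(\<Sum>i | i < m \<and> i \<in> set opt. c i * (ln (x (length js) i) - ln (x 0 i))) \<le> scale"
proof -
  have "(\<Sum>i | i < m \<and> i \<in> set opt. c i * (ln (x (length js) i) - ln (x 0 i)))
      \<le> (\<Sum>i | i < m \<and> i \<in> set opt. c i * ln (real m + 1))"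
  proof (rule sum_mono)
    fix i assume i: "i \<in> {i. i < m \<and> i \<in> set opt}"
    show "c i * (ln (x (length js) i) - ln (x 0 i)) \<le> c i * ln (real m + 1)"
    proof (cases "c i = 0")
      case False
      have "ln (x (length js) i) \<le> 0" using x_invariant[of "length js" i] by simp
      moreover have "ln (x 0 i) = - ln (real m)"
        using False m_pos unfolding x_0 by (simp add: ln_div)
      moreover have "ln (real m) \<le> ln (real m + 1)" using m_pos by simp
      ultimately have "ln (x (length js) i) - ln (x 0 i) \<le> ln (real m + 1)" by linarith
      then show ?thesis using c_nonneg[of i] i by (intro mult_left_mono) auto
    qed simp
  qed
  also have "\<dots> = sched_cost m c opt * ln (real m + 1)"
    by (simp add: sched_cost_def sum_distrib_right)
  also have "\<dots> \<le> C * ln (real m + 1)"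
    using opt_cost by (intro mult_right_mono) auto
  also have "\<dots> \<le> scale" by (simp add: scale_def)
  finally show ?thesis .
qed

text \<open>One \<open>scale\<close> pays for the scaled load of \<open>opt\<close>, the other for
  the growth of the potential. For \<open>L = 0\<close> the quotient \<open>scale / L\<close> is
  \<open>0\<close>.\<close>

lemma sum_T: "(\<Sum>j<length js. T j) \<le> 2 * scale"
proof -
  have "(\<Sum>j<length js. scaled (js ! j) (opt ! j)) = total_load js opt * (scale / L)"
    by (simp add: scaled_def total_load_def sum_distrib_right sum_divide_distrib)
  also have "\<dots> \<le> L * (scale / L)"
    using opt_load scale_pos L_nonneg by (intro mult_right_mono) auto
  also have "\<dots> \<le> scale" using scale_pos by (cases "L = 0") auto
  finally show ?thesis
    using sum_excess[of "length js"] potential_le_scale by (simp add: sum_subtractf)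
qed

text \<open>Each of at most \<open>m\<close> affordable machines starts with cost at most
  \<open>C / real m\<close>, and job \<open>k\<close> adds at most \<open>T k\<close>.\<close>

lemma fractional_cost: "(\<Sum>i | i < m \<and> c i \<le> C. c i * x (length js) i) \<le> C + 2 * scale"
proof -
  let ?I = "{i. i < m \<and> c i \<le> C}"
  have "(\<Sum>i\<in>?I. c i * x k i) \<le> (\<Sum>i\<in>?I. c i * x 0 i) + (\<Sum>j<k. T j)" if "k \<le> length js" for k
    using that
  proof (induction k)
    case (Suc k)
    then show ?case
      using cost_gain[of k] by (simp add: algebra_simps sum_subtractf)
  qed simp
  from this[OF order.refl] sum_T
  have "(\<Sum>i\<in>?I. c i * x (length js) i) \<le> (\<Sum>i\<in>?I. c i * x 0 i) + 2 * scale" by simp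
  moreover have "(\<Sum>i\<in>?I. c i * x 0 i) \<le> (\<Sum>i\<in>?I. C / real m)"
  proof (rule sum_mono)
    fix i assume "i \<in> ?I"
    then show "c i * x 0 i \<le> C / real m"
      using C_nonneg unfolding x_0 by (auto intro: divide_right_mono)
  qed
  moreover have "(\<Sum>i\<in>?I. C / real m) \<le> (\<Sum>i<m. C / real m)"
    using C_nonneg by (intro sum_mono2) auto
  moreover have "(\<Sum>i<m. C / real m) = C" using m_pos by simp
  ultimately show ?thesis by simp
qed

section \<open>The rounded schedule for a fixed draw of the thresholds\<close>

lemma fallback:
  assumes "k < length js"
  shows "fallback (js ! k) < m" "c (fallback (js ! k)) \<le> C"
    "(js ! k) (fallback (js ! k)) \<le> (js ! k) (opt ! k)"
proof -
  let ?S = "{i. i < m \<and> c i \<le> C}"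
  have mem: "opt ! k \<in> ?S" using opt_usable[OF assms] by (simp add: usable_def)
  have "fallback (js ! k) \<in> ?S"
    unfolding fallback_def using mem by (intro arg_min_if_finite(1)) auto
  then show "fallback (js ! k) < m" "c (fallback (js ! k)) \<le> C" by auto
  show "(js ! k) (fallback (js ! k)) \<le> (js ! k) (opt ! k)"
    unfolding fallback_def using mem by (intro arg_min_least) auto
qed

lemma hit_usable: "k < length js \<Longrightarrow> hit \<omega> (arrived k) i \<Longrightarrow> i \<in> usable (js ! k)"
  by (simp add: hit_def candidates_arrived)

lemma choice_usable:
  assumes "k < length js"
  shows "choice \<omega> (arrived k) < m" "c (choice \<omega> (arrived k)) \<le> C"
proof -
  have "choice \<omega> (arrived k) < m \<and> c (choice \<omega> (arrived k)) \<le> C"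
  proof (cases "\<exists>i. hit \<omega> (arrived k) i")
    case True
    from hit_usable[OF assms choice_hit[OF this]] show ?thesis by (simp add: usable_def)
  next
    case False
    then show ?thesis using fallback[OF assms] by (simp add: choice_def last_arrived assms)
  qed
  then show "choice \<omega> (arrived k) < m" "c (choice \<omega> (arrived k)) \<le> C" by auto
qed

lemma sched_eq:
  "sched (startup_alg \<omega>) m c C L js = map (\<lambda>k. choice \<omega> (arrived k)) [0..<length js]"
  by (simp add: sched_def startup_alg_def)

lemma sched_valid: "valid_schedule m js (sched (startup_alg \<omega>) m c C L js)"
  using choice_usable by (auto simp: valid_schedule_def sched_eq)

lemma set_sched: "set (sched (startup_alg \<omega>) m c C L js) = (\<lambda>k. choice \<omega> (arrived k)) ` {..<length js}"
  by (auto simp: sched_eq)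

lemma total_load_sched:
  "total_load js (sched (startup_alg \<omega>) m c C L js) = (\<Sum>k<length js. (js ! k) (choice \<omega> (arrived k)))"
  by (simp add: total_load_def sched_eq)

text \<open>This undoes the scaling. For \<open>L = 0\<close> the level says nothing about times,
  but \<open>usable\<close> already forces them to be at most \<open>0\<close>.\<close>

lemma candidate_load:
  assumes k: "k < length js" and i: "i \<in> candidates (arrived k)"
  shows "(js ! k) i \<le> T k * (L / scale)"
proof (cases "L = 0")
  case True
  have "(js ! k) i \<le> L" using i k by (simp add: candidates_arrived usable_def)
  with True show ?thesis by simp
next
  case False
  then have "L > 0" using L_nonneg by simp
  moreover have "(js ! k) i * scale / L \<le> T k"
    using i k by (simp add: candidates_arrived scaled_def)
  ultimately show ?thesis using scale_pos by (simp add: field_simps)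
qed

text \<open>The bound holds for every draw: the levels, scaled back, account for
  \<open>2 * L\<close>, and fallback jobs take no longer than under \<open>opt\<close>.\<close>

lemma load_le: "total_load js (sched (startup_alg \<omega>) m c C L js) \<le> 3 * L"
proof -
  have "(js ! k) (choice \<omega> (arrived k)) \<le> T k * (L / scale) + (js ! k) (opt ! k)"
    if k: "k < length js" for k
  proof (cases "\<exists>i. hit \<omega> (arrived k) i")
    case True
    from choice_hit[OF this] have "choice \<omega> (arrived k) \<in> candidates (arrived k)"
      by (simp add: hit_def)
    from candidate_load[OF k this] show ?thesis using p_nonneg[OF k opt_less[OF k]] by simp
  next
    case False
    have "0 \<le> T k * (L / scale)" using T_nonneg[OF k] L_nonneg scale_pos by simp
    with False fallback(3)[OF k] show ?thesis by (simp add: choice_def last_arrived k)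
  qed
  then have "total_load js (sched (startup_alg \<omega>) m c C L js)
      \<le> (\<Sum>k<length js. T k * (L / scale) + (js ! k) (opt ! k))"
    unfolding total_load_sched by (intro sum_mono) auto
  also have "\<dots> = (\<Sum>k<length js. T k) * (L / scale) + total_load js opt"
    by (simp add: sum.distrib sum_distrib_right sum_divide_distrib total_load_def)
  also have "\<dots> \<le> 2 * scale * (L / scale) + L"
    using sum_T opt_load L_nonneg scale_pos by (intro add_mono mult_right_mono) auto
  also have "\<dots> = 3 * L" using scale_pos by simp
  finally show ?thesis .
qed

text \<open>Rates and weights only grow, so a machine opened by a hit still passes the test with the
  final rate and weight and is charged once. Every job without a hit is charged \<open>C\<close> for
  its fallback machine.\<close>

lemma cost_le:
  "sched_cost m c (sched (startup_alg \<omega>) m c C L js) \<le>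
     (\<Sum>i | i < m \<and> c i \<le> C. c i * of_bool (\<omega> i \<le> rate (length js) * x (length js) i)) +
     (\<Sum>k<length js. C * of_bool (\<forall>i. \<not> hit \<omega> (arrived k) i))"
proof -
  let ?H = "{i. i < m \<and> c i \<le> C \<and> \<omega> i \<le> rate (length js) * x (length js) i}"
  let ?K = "{k. k < length js \<and> (\<forall>i. \<not> hit \<omega> (arrived k) i)}"
  let ?f = "\<lambda>k. fallback (js ! k)"
  have "choice \<omega> (arrived k) \<in> ?H \<union> ?f ` ?K" if k: "k < length js" for k
  proof (cases "\<exists>i. hit \<omega> (arrived k) i")
    case True
    let ?i = "choice \<omega> (arrived k)"
    have "\<omega> ?i \<le> rate (Suc k) * x (Suc k) ?i"
      using choice_hit[OF True] k by (simp add: hit_def)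
    also have "\<dots> \<le> rate (length js) * x (length js) ?i"
      using k x_invariant[of "Suc k" ?i]
      by (intro mult_mono rate_mono x_mono rate_nonneg) auto
    finally show ?thesis using choice_usable[OF k] by simp
  next
    case False
    then show ?thesis using k by (auto simp: choice_def last_arrived)
  qed
  then have sub: "{i. i < m \<and> i \<in> set (sched (startup_alg \<omega>) m c C L js)} \<subseteq> ?H \<union> ?f ` ?K"
    unfolding set_sched by blast
  have cK: "0 \<le> c i" if "i \<in> ?f ` ?K" for i using that fallback(1) c_nonneg by blast
  have "sched_cost m c (sched (startup_alg \<omega>) m c C L js) \<le> sum c (?H \<union> ?f ` ?K)"
    unfolding sched_cost_def using sub cK c_nonneg by (intro sum_mono2) auto
  also have "\<dots> \<le> sum c ?H + sum c (?f ` ?K)"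
    using cK c_nonneg by (subst sum.union_inter[symmetric]) (auto intro!: sum_nonneg)
  also have "sum c (?f ` ?K) \<le> (\<Sum>k\<in>?K. c (?f k))"
    using cK by (intro sum_image_le[of ?K c ?f, unfolded comp_def]) auto
  also have "\<dots> \<le> (\<Sum>k\<in>?K. C)"
    using fallback(2) by (intro sum_mono) auto
  also have "(\<Sum>k\<in>?K. C) = (\<Sum>k<length js. C * of_bool (\<forall>i. \<not> hit \<omega> (arrived k) i))"
    by (rule sum.mono_neutral_cong_left) auto
  also have "sum c ?H = (\<Sum>i | i < m \<and> c i \<le> C. c i * of_bool (\<omega> i \<le> rate (length js) * x (length js) i))"
    by (rule sum.mono_neutral_cong_left) auto
  finally show ?thesis by simp
qed

end

subsection \<open>Rounding with independent uniform thresholds\<close>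

definition unif :: "real measure" where
  "unif = uniform_measure lborel {0..1}"

text \<open>Infinitely many coordinates let one probability space serve every number of
  machines.\<close>

definition thresholds :: "(nat \<Rightarrow> real) measure" where
  "thresholds = PiM UNIV (\<lambda>_. unif)"

lemma sets_unif [measurable_cong, simp]: "sets unif = sets borel"
  by (simp add: unif_def)

lemma prob_space_unif: "prob_space unif"
  unfolding unif_def by (rule prob_space_uniform_measure) auto

interpretation thresholds: product_prob_space "\<lambda>_::nat. unif" UNIV
  by (simp add: product_prob_space_def product_prob_space_axioms_def product_sigma_finite_def
      prob_space_unif prob_space_imp_sigma_finite)

lemma prob_space_thresholds: "prob_space thresholds"
  unfolding thresholds_def by (rule thresholds.prob_space_axioms)

lemma measurable_threshold [measurable]: "(\<lambda>\<omega>. \<omega> i) \<in> borel_measurable thresholds"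
  using measurable_component_singleton[of i UNIV "\<lambda>_. unif"]
  by (simp add: thresholds_def cong: measurable_cong_sets)

lemma space_thresholds: "space thresholds = UNIV"
  by (simp add: thresholds_def space_PiM unif_def)

lemma unif_atMost:
  assumes "0 \<le> t"
  shows "measure unif {..t} \<le> t"
proof -
  have "{0..1} \<inter> {..t} = {0..min 1 t}" by auto
  then have "measure unif {..t} = min 1 t"
    unfolding unif_def using assms by (subst measure_uniform_measure) auto
  then show ?thesis by simp
qed

text \<open>The estimate \<open>1 - t \<le> exp (- t)\<close> will turn a product over machines into
  the exponential of a sum.\<close>

lemma unif_greaterThan:
  assumes "0 \<le> t"
  shows "measure unif {t<..} \<le> exp (- t)"
proof -
  have "{0..1} \<inter> {t<..} = {t<..1}" using assms by auto
  then have "measure unif {t<..} = max 0 (1 - t)"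
    unfolding unif_def by (subst measure_uniform_measure) (auto simp: max_def)
  then show ?thesis using exp_ge_add_one_self[of "- t"] by simp
qed

text \<open>The event is a cylinder of the product measure; this is where independence
  enters.\<close>

lemma measure_thresholds_all:
  assumes "finite J" "\<And>i. i \<in> J \<Longrightarrow> X i \<in> sets borel"
  shows "measure thresholds {\<omega>. \<forall>i\<in>J. \<omega> i \<in> X i} = (\<Prod>i\<in>J. measure unif (X i))"
proof -
  have "{\<omega>. \<forall>i\<in>J. \<omega> i \<in> X i} = prod_emb UNIV (\<lambda>_. unif) J (Pi\<^sub>E J X)"
    by (auto simp: prod_emb_def space_PiM unif_def PiE_iff extensional_def)
  with thresholds.measure_PiM_emb[of J X] assms show ?thesis
    by (simp add: thresholds_def)
qed

lemma sum_inverse_squares_le_one: "(\<Sum>k<n. 1 / (real k + 2)\<^sup>2) \<le> 1"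
proof -
  \<comment> \<open>The sharper bound telescopes, as the next term is at most
    \<open>1 / (real n + 1) - 1 / (real n + 2)\<close>.\<close>
  have "(\<Sum>k<n. 1 / (real k + 2)\<^sup>2) \<le> 1 - 1 / (real n + 1)"
  proof (induction n)
    case (Suc n)
    have "1 / (real n + 2)\<^sup>2 \<le> 1 / ((real n + 1) * (real n + 2))"
      unfolding power2_eq_square by (intro divide_left_mono mult_right_mono) auto
    also have "\<dots> = 1 / (real n + 1) - 1 / (real n + 2)"
      by (simp add: field_simps)
    finally show ?case using Suc.IH by (simp add: add.commute)
  qed simp
  also have "\<dots> \<le> 1" by simp
  finally show ?thesis .
qed

text \<open>This lets lower-order terms be absorbed into a product of two logarithms.\<close>

lemma half_le_ln_Suc:
  assumes "0 < k"
  shows "1 / 2 \<le> ln (real k + 1)"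
proof -
  have "1 / 2 \<le> ln (2::real)" using ln2_ge_two_thirds by simp
  also have "\<dots> \<le> ln (real k + 1)" using assms by simp
  finally show ?thesis .
qed

lemma (in startup) measurable_hit [measurable]: "Measurable.pred thresholds (\<lambda>\<omega>. hit \<omega> js i)"
  unfolding hit_def by measurable

lemma (in startup) measurable_choice [measurable]:
  "(\<lambda>\<omega>. choice \<omega> js) \<in> measurable thresholds (count_space UNIV)"
  unfolding choice_def by measurable

section \<open>Expectations over the thresholds\<close>

context startup_instance
begin

lemma prob_no_hit:
  assumes k: "k < length js"
  shows "measure thresholds {\<omega>. \<forall>i. \<not> hit \<omega> (arrived k) i} \<le> 1 / (real k + 2)\<^sup>2"
proof -
  let ?J = "candidates (arrived k)" and ?r = "rate (Suc k)"
  have x: "0 \<le> x (Suc k) i" for i using x_invariant[of "Suc k" i] k by simp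
  have "{\<omega>. \<forall>i. \<not> hit \<omega> (arrived k) i} = {\<omega>. \<forall>i\<in>?J. \<omega> i \<in> {?r * x (Suc k) i<..}}"
    using k by (auto simp: hit_def not_le)
  then have "measure thresholds {\<omega>. \<forall>i. \<not> hit \<omega> (arrived k) i} =
      (\<Prod>i\<in>?J. measure unif {?r * x (Suc k) i<..})"
    using finite_candidates by (simp only:) (rule measure_thresholds_all; simp)
  also have "\<dots> \<le> (\<Prod>i\<in>?J. exp (- (?r * x (Suc k) i)))"
    using x rate_nonneg by (intro prod_mono conjI unif_greaterThan mult_nonneg_nonneg) auto
  also have "\<dots> = exp (- (?r * (\<Sum>i\<in>?J. x (Suc k) i)))"
    using finite_candidates by (simp add: exp_sum sum_distrib_left flip: sum_negf)
  \<comment> \<open>The raised weights of the candidates sum to at least \<open>1\<close>, by the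
    choice of the level.\<close>
  also have "\<dots> \<le> exp (- (?r * 1))"
    using sum_candidates[OF k] rate_nonneg
    by (simp only: exp_le_cancel_iff neg_le_iff_le) (intro mult_left_mono)
  \<comment> \<open>Job \<open>k\<close> is the \<open>Suc k\<close>-th arrival, so its rate is
    \<open>2 * ln (real k + 2)\<close>.\<close>
  also have "\<dots> = 1 / (real k + 2)\<^sup>2"
    using exp_of_nat_mult[of 2 "ln (real k + 2)"]
    by (simp add: rate_def exp_minus inverse_eq_divide add.commute)
  finally show ?thesis .
qed

lemma prob_opened:
  assumes "0 \<le> t"
  shows "measure thresholds {\<omega>. \<omega> i \<le> t} \<le> t"
  using measure_thresholds_all[of "{i}" "\<lambda>_. {..t}"] unif_atMost[OF assms] by simp

text \<open>Taking expectations in \<open>cost_le\<close>, hits cost at most the final rate times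
  the fractional cost, and the failure probabilities sum to at most \<open>1\<close>.\<close>

lemma expected_cost_bound:
  "(\<integral>\<omega>. sched_cost m c (sched (startup_alg \<omega>) m c C L js) \<partial>thresholds)
     \<le> rate (length js) * (C + 2 * scale) + C"
proof -
  interpret P: prob_space thresholds by (rule prob_space_thresholds)
  let ?I = "{i. i < m \<and> c i \<le> C}" and ?n = "length js"
  let ?E = "\<lambda>i. {\<omega>. \<omega> i \<le> rate ?n * x ?n i}"
  let ?N = "\<lambda>k. {\<omega>. \<forall>i. \<not> hit \<omega> (arrived k) i}"
  let ?g = "\<lambda>\<omega>. (\<Sum>i\<in>?I. c i * indicator (?E i) \<omega>) + (\<Sum>k<?n. C * indicator (?N k) \<omega>)"
  have E[measurable]: "?E i \<in> sets thresholds" for i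
  proof -
    have "{\<omega> \<in> space thresholds. \<omega> i \<le> rate ?n * x ?n i} \<in> sets thresholds" by measurable
    then show ?thesis by (simp add: space_thresholds)
  qed
  have N[measurable]: "?N k \<in> sets thresholds" for k
  proof -
    have "{\<omega> \<in> space thresholds. \<forall>i. \<not> hit \<omega> (arrived k) i} \<in> sets thresholds" by measurable
    then show ?thesis by (simp add: space_thresholds)
  qed
  have int: "integrable thresholds (\<lambda>\<omega>. a * indicator S \<omega>)"
    if "S \<in> sets thresholds" for a :: real and S
    using that by (intro integrable_mult_right integrable_real_indicator) (auto simp: P.emeasure_eq_measure)
  have expect: "(\<integral>\<omega>. (\<Sum>i\<in>S. a i * indicator (D i) \<omega>) \<partial>thresholds) =
      (\<Sum>i\<in>S. a i * measure thresholds (D i))"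
    if "\<And>i. D i \<in> sets thresholds" for S and a :: "nat \<Rightarrow> real" and D
    by (subst Bochner_Integration.integral_sum[OF int[OF that]]) (simp add: space_thresholds)
  have c: "0 \<le> c i" if "i \<in> ?I" for i using that c_nonneg by simp
  have "(\<integral>\<omega>. sched_cost m c (sched (startup_alg \<omega>) m c C L js) \<partial>thresholds) \<le> (\<integral>\<omega>. ?g \<omega> \<partial>thresholds)"
  proof (rule integral_mono')
    show "integrable thresholds ?g"
      by (intro Bochner_Integration.integrable_add Bochner_Integration.integrable_sum int E N)
    show "sched_cost m c (sched (startup_alg \<omega>) m c C L js) \<le> ?g \<omega>" for \<omega>
      using cost_le[of \<omega>] by (simp add: indicator_def of_bool_def)
    show "0 \<le> ?g \<omega>" for \<omega>
      using c C_nonneg by (intro add_nonneg_nonneg sum_nonneg mult_nonneg_nonneg) auto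
  qed
  also have "(\<integral>\<omega>. ?g \<omega> \<partial>thresholds) =
      (\<Sum>i\<in>?I. c i * measure thresholds (?E i)) + (\<Sum>k<?n. C * measure thresholds (?N k))"
    using E N
    by (subst Bochner_Integration.integral_add)
      (auto simp only: expect intro!: Bochner_Integration.integrable_sum int)
  also have "\<dots> \<le> (\<Sum>i\<in>?I. c i * (rate ?n * x ?n i)) + (\<Sum>k<?n. C * (1 / (real k + 2)\<^sup>2))"
    using c C_nonneg x_invariant[of ?n] rate_nonneg
    by (intro add_mono sum_mono mult_left_mono prob_opened prob_no_hit mult_nonneg_nonneg)
      (auto intro: less_imp_le)
  also have "\<dots> = rate ?n * (\<Sum>i\<in>?I. c i * x ?n i) + C * (\<Sum>k<?n. 1 / (real k + 2)\<^sup>2)"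
    by (simp add: sum_distrib_left algebra_simps)
  also have "\<dots> \<le> rate ?n * (C + 2 * scale) + C * 1"
    using fractional_cost rate_nonneg C_nonneg sum_inverse_squares_le_one
    by (intro add_mono mult_left_mono) auto
  finally show ?thesis by simp
qed

lemma expected_cost:
  "(\<integral>\<omega>. sched_cost m c (sched (startup_alg \<omega>) m c C L js) \<partial>thresholds)
     \<le> 12 * ln (real m + 1) * ln (real (length js) + 1) * C"
proof (cases "C = 0")
  case True
  \<comment> \<open>Here \<open>scale\<close> is \<open>1\<close> and not a multiple of
    \<open>C\<close>, but every machine chosen is free.\<close>
  have "sched_cost m c (sched (startup_alg \<omega>) m c C L js) = 0" for \<omega>
    unfolding sched_cost_def set_sched
    using choice_usable(2) c_nonneg True by (intro sum.neutral) (auto intro: antisym)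
  then show ?thesis using True by simp
next
  case False
  define u v where "u = ln (real m + 1)" and "v = ln (real (length js) + 1)"
  have u: "1 / 2 \<le> u" and v: "1 / 2 \<le> v"
    using half_le_ln_Suc m_pos nonempty by (auto simp: u_def v_def)
  have "v * (1 / 2) \<le> v * u" using u v by (intro mult_left_mono) auto
  \<comment> \<open>As \<open>u\<close> and \<open>v\<close> are at least \<open>1 / 2\<close>, both
    \<open>2 * v\<close> and \<open>1\<close> are at most \<open>4 * (v * u)\<close>, which gives
    \<open>12\<close>.\<close>
  then have "2 * v + 4 * (v * u) + 1 \<le> 12 * (v * u)" using v by linarith
  then have "(2 * v + 4 * (v * u) + 1) * C \<le> 12 * (v * u) * C"
    using C_nonneg by (rule mult_right_mono)
  moreover have "rate (length js) * (C + 2 * scale) + C = (2 * v + 4 * (v * u) + 1) * C"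
    using False by (simp add: rate_def scale_def u_def v_def algebra_simps)
  ultimately show ?thesis using expected_cost_bound by (simp add: u_def v_def mult_ac)
qed

lemma expected_load:
  "(\<integral>\<omega>. total_load js (sched (startup_alg \<omega>) m c C L js) \<partial>thresholds) \<le> 3 * L"
proof -
  interpret P: prob_space thresholds by (rule prob_space_thresholds)
  have "(\<integral>\<omega>. total_load js (sched (startup_alg \<omega>) m c C L js) \<partial>thresholds)
      \<le> (\<integral>\<omega>. 3 * L \<partial>thresholds)"
    using load_le L_nonneg by (intro integral_mono') auto
  then show ?thesis by (simp add: P.prob_space)
qed

lemma sched_cost_measurable:
  "(\<lambda>\<omega>. sched_cost m c (sched (startup_alg \<omega>) m c C L js)) \<in> borel_measurable thresholds"
proof -
  \<comment> \<open>A finite sum over machines, with conditions on finitely many measurable choices,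
    makes measurability evident.\<close>
  have "sched_cost m c (sched (startup_alg \<omega>) m c C L js) =
      (\<Sum>i<m. if \<exists>k\<in>{..<length js}. choice \<omega> (arrived k) = i then c i else 0)" for \<omega>
    unfolding sched_cost_def set_sched by (rule sum.mono_neutral_cong_left) auto
  then show ?thesis by (simp only:) measurable
qed

lemma total_load_measurable:
  "(\<lambda>\<omega>. total_load js (sched (startup_alg \<omega>) m c C L js)) \<in> borel_measurable thresholds"
  unfolding total_load_sched
  by (intro borel_measurable_sum measurable_compose[OF measurable_choice]) simp

end

theorem theorem5:
  shows "\<exists>(\<Omega> :: (nat \<Rightarrow> real) measure) (R :: (nat \<Rightarrow> real) \<Rightarrow> online_alg) (a::real) (b::real).
     prob_space \<Omega> \<and>
     (\<forall>m c js C L. valid_instance m c js \<and> feasible_guess m c js C L \<longrightarrow>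
        (\<forall>\<omega>\<in>space \<Omega>. valid_schedule m js (sched (R \<omega>) m c C L js)) \<and>
        (\<lambda>\<omega>. sched_cost m c (sched (R \<omega>) m c C L js)) \<in> borel_measurable \<Omega> \<and>
        (\<lambda>\<omega>. total_load js (sched (R \<omega>) m c C L js)) \<in> borel_measurable \<Omega> \<and>
        (\<integral>\<omega>. sched_cost m c (sched (R \<omega>) m c C L js) \<partial>\<Omega>)
           \<le> a * ln (real m + 1) * ln (real (length js) + 1) * C \<and>
        (\<integral>\<omega>. total_load js (sched (R \<omega>) m c C L js) \<partial>\<Omega>) \<le> b * L)"
proof (rule exI[of _ thresholds], rule exI[of _ startup_alg], rule exI[of _ 12], rule exI[of _ 3],
    intro conjI[OF prob_space_thresholds] allI impI, elim conjE)
  fix m c js C L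
  assume *: "valid_instance m c js" "feasible_guess m c js C L"
  let ?S = "\<lambda>\<omega>. sched (startup_alg \<omega>) m c C L js"
  show "(\<forall>\<omega>\<in>space thresholds. valid_schedule m js (?S \<omega>)) \<and>
        (\<lambda>\<omega>. sched_cost m c (?S \<omega>)) \<in> borel_measurable thresholds \<and>
        (\<lambda>\<omega>. total_load js (?S \<omega>)) \<in> borel_measurable thresholds \<and>
        (\<integral>\<omega>. sched_cost m c (?S \<omega>) \<partial>thresholds)
           \<le> 12 * ln (real m + 1) * ln (real (length js) + 1) * C \<and>
        (\<integral>\<omega>. total_load js (?S \<omega>) \<partial>thresholds) \<le> 3 * L"
  \<comment> \<open>Without jobs \<open>m\<close> may be \<open>0\<close>; the cost bound is then
    \<open>0\<close> because \<open>ln 1 = 0\<close>, and no machine is opened.\<close>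
  proof (cases "js = []")
    case True
    then show ?thesis using *(2)
      by (auto simp: feasible_guess_def valid_schedule_def sched_def sched_cost_def total_load_def)
  next
    case False
    with * obtain opt where "startup_instance m c C L js opt"
      unfolding feasible_guess_def startup_instance_def by blast
    then interpret startup_instance m c C L js opt .
    show ?thesis
      using sched_valid sched_cost_measurable total_load_measurable expected_cost expected_load
      by blast
  qed
qed

end
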